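(* Fix a positive integer $n$. For a positive integer $M$, let $a_1,\dots,a_n$ be chosen uniformly and independently at random from $\{1,2,\dots,M\}$, and let $\mathcal{S}=\langle a_1,\dots,a_n\rangle$. Then the probability that $\mathcal{S}$ has full quotient rank tends to $1$ as $M\to\infty$. More precisely, this probability is $1-O(M^{-1/n})$ as $M\to\infty$, where the implied constant may depend on $n$.
   Context: Here $\mathbb{N}=\{0,1,2,\dots\}$. A numerical semigroup is a subset of $\mathbb{N}$ containing $0$ and closed under addition (finite complement in $\mathbb{N}$ is not required). $\langle a_1,\dots,a_n\rangle=\{a_1x_1+\cdots+a_nx_n: x_i\in\mathbb{N}\}$. The embedding dimension $\mathsf{e}(\mathcal{S})$ is the number of elements of the (unique) minimal generating set of $\mathcal{S}$. For a positive integer $d$, $\frac{\mathcal{T}}{d}=\{t\in\mathbb{N}: dt\in\mathcal{T}\}$. A numerical semigroup $\mathcal{S}$ is a $k$-quotient if $\mathcal{S}=\langle c_1,\dots,c_k\rangle/d$ for some positive integers $d,c_1,\dots,c_k$ (the $c_i$ need not be distinct or form a minimal generating set). The quotient rank of $\mathcal{S}$ is the smallest $k$ such that $\mathcal{S}$ is a $k$-quotient; it is at most $\mathsf{e}(\mathcal{S})$. $\mathcal{S}$ has full quotient rank if its quotient rank equals $\mathsf{e}(\mathcal{S})$. *)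

theory Defs
  imports "HOL-Probability.Probability" "HOL-Library.Landau_Symbols"
begin

definition numerical_semigroup :: "nat set \<Rightarrow> bool" where
  "numerical_semigroup S \<longleftrightarrow> 0 \<in> S \<and> (\<forall>x\<in>S. \<forall>y\<in>S. x + y \<in> S)"

(* The semigroup generated by the family (a i) for i in I.  Only used for finite I, since
   sums over infinite sets are 0.  A tuple is a family indexed by {..<n}; a set A of
   generators is the family id indexed by A. *)
definition generated :: "'i set \<Rightarrow> ('i \<Rightarrow> nat) \<Rightarrow> nat set" where
  "generated I a = {\<Sum>i\<in>I. a i * x i | x. True}"

(* Finiteness of A loses nothing: every numerical semigroup is finitely generated, so no
   infinite generating set is minimal. *)
definition minimal_generating_set :: "nat set \<Rightarrow> nat set \<Rightarrow> bool" where
  "minimal_generating_set S A \<longleftrightarrow>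
     finite A \<and> generated A id = S \<and> (\<forall>B. B \<subset> A \<longrightarrow> generated B id \<noteq> S)"

definition embedding_dim :: "nat set \<Rightarrow> nat" where
  "embedding_dim S = card (THE A. minimal_generating_set S A)"

definition semigroup_quotient :: "nat set \<Rightarrow> nat \<Rightarrow> nat set" where
  "semigroup_quotient T d = {t. d * t \<in> T}"

definition is_quotient :: "nat \<Rightarrow> nat set \<Rightarrow> bool" where
  "is_quotient k S \<longleftrightarrow> numerical_semigroup S \<and>
     (\<exists>d>0. \<exists>c. (\<forall>i<k. 0 < c i) \<and> S = semigroup_quotient (generated {..<k} c) d)"

definition quotient_rank :: "nat set \<Rightarrow> nat" where
  "quotient_rank S = (LEAST k. is_quotient k S)"

definition full_quotient_rank :: "nat set \<Rightarrow> bool" where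
  "full_quotient_rank S \<longleftrightarrow> quotient_rank S = embedding_dim S"

(* Coordinates outside {..<n} take the dummy value 0.  Only M > 0 is meaningful. *)
definition random_generators :: "nat \<Rightarrow> nat \<Rightarrow> (nat \<Rightarrow> nat) pmf" where
  "random_generators n M = Pi_pmf {..<n} 0 (\<lambda>_. pmf_of_set {1..M})"

definition prob_full_quotient_rank :: "nat \<Rightarrow> nat \<Rightarrow> real" where
  "prob_full_quotient_rank n M =
     measure_pmf.prob (random_generators n M) {a. full_quotient_rank (generated {..<n} a)}"

end

theory Submission
  imports Defs
begin

text \<open>If \<open>a\<^sub>1, \<dots>, a\<^sub>n\<close> lie in a \<open>k\<close>-quotient with \<open>k < n\<close>, pigeonhole modulo 2 on the coefficient
  vectors of the \<open>d a\<^sub>i\<close> yields a nonempty set \<open>I\<close> with \<open>(\<Sum>i\<in>I. a\<^sub>i) / 2\<close> in the quotient.  Hence, if the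
  semigroup generated by the \<open>a\<^sub>i\<close> is not of full quotient rank, they satisfy a linear equation
  \<open>(\<Sum>i\<in>I. a\<^sub>i) = 2 (\<Sum>i. y\<^sub>i a\<^sub>i)\<close>, which is nontrivial because its coefficients in \<open>I\<close> are odd.  Each
  such equation has probability at most \<open>1/M\<close>.  Outside an event of probability \<open>n/K\<close> all \<open>a\<^sub>i\<close>
  exceed \<open>M/K\<close>, so that \<open>y\<^sub>i \<le> n K\<close>; moreover \<open>y\<^sub>j \<le> n\<close> where \<open>a\<^sub>j\<close> is maximal.  So only
  \<open>O(K ^ (n - 1))\<close> equations are relevant, and \<open>K \<approx> M powr (1/n)\<close> balances both terms.\<close>

section \<open>Generated semigroups and their irreducible elements\<close>

lemma numerical_semigroup_generated: "numerical_semigroup (generated I a)"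
  unfolding numerical_semigroup_def generated_def
proof (intro conjI ballI)
  show "0 \<in> {\<Sum>i\<in>I. a i * x i |x. True}"
    by (auto intro!: exI[of _ "\<lambda>_. 0"])
  fix s t assume "s \<in> {\<Sum>i\<in>I. a i * x i |x. True}" "t \<in> {\<Sum>i\<in>I. a i * x i |x. True}"
  then obtain x y where "s = (\<Sum>i\<in>I. a i * x i)" "t = (\<Sum>i\<in>I. a i * y i)"
    by auto
  then have "s + t = (\<Sum>i\<in>I. a i * (x i + y i))"
    by (simp add: sum.distrib algebra_simps)
  then show "s + t \<in> {\<Sum>i\<in>I. a i * x i |x. True}"
    by (auto intro!: exI[of _ "\<lambda>i. x i + y i"])
qed

lemma generated_mem:
  assumes "finite I" "i \<in> I"
  shows "a i \<in> generated I a"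
proof -
  have "(\<Sum>j\<in>I. a j * (if j = i then 1 else 0)) = a i"
    using assms by (simp add: if_distrib[of "\<lambda>x. _ * x"] cong: if_cong)
  then show ?thesis
    unfolding generated_def mem_Collect_eq
    by (intro exI[of _ "\<lambda>j. if j = i then 1 else 0"]) simp
qed

lemma numerical_semigroup_mult:
  assumes "numerical_semigroup T" "t \<in> T"
  shows "t * m \<in> T"
  using assms by (induction m) (auto simp: numerical_semigroup_def)

lemma numerical_semigroup_sum:
  assumes "numerical_semigroup T" "\<And>i. i \<in> I \<Longrightarrow> f i \<in> T"
  shows "sum f I \<in> T"
  using assms(2) by (induction I rule: infinite_finite_induct)
    (use assms(1) in \<open>auto simp: numerical_semigroup_def\<close>)

lemma generated_subset:
  assumes "numerical_semigroup T" "\<And>i. i \<in> I \<Longrightarrow> a i \<in> T"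
  shows "generated I a \<subseteq> T"
  using assms by (auto simp: generated_def intro!: numerical_semigroup_sum numerical_semigroup_mult)

lemma generated_reindex:
  assumes "bij_betw f I J"
  shows "generated I (a \<circ> f) = generated J a"
proof -
  have "generated J a \<subseteq> generated I (a \<circ> f)"
    unfolding generated_def
  proof clarify
    fix x
    have "(\<Sum>j\<in>J. a j * x j) = (\<Sum>i\<in>I. (a \<circ> f) i * (x \<circ> f) i)"
      using sum.reindex_bij_betw[OF assms, of "\<lambda>j. a j * x j"] by simp
    then show "\<exists>y. (\<Sum>j\<in>J. a j * x j) = (\<Sum>i\<in>I. (a \<circ> f) i * y i) \<and> True"
      by blast
  qed
  moreover have "generated I (a \<circ> f) \<subseteq> generated J a"
    unfolding generated_def
  proof clarify
    fix x
    have "(\<Sum>i\<in>I. (a \<circ> f) i * x i) = (\<Sum>i\<in>I. a (f i) * x (inv_into I f (f i)))"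
      using assms by (intro sum.cong) (auto simp: bij_betw_def)
    also have "\<dots> = (\<Sum>j\<in>J. a j * x (inv_into I f j))"
      using sum.reindex_bij_betw[OF assms, of "\<lambda>j. a j * x (inv_into I f j)"] by simp
    finally show "\<exists>y. (\<Sum>i\<in>I. (a \<circ> f) i * x i) = (\<Sum>j\<in>J. a j * y j) \<and> True"
      by (intro exI[of _ "\<lambda>j. x (inv_into I f j)"]) simp
  qed
  ultimately show ?thesis by blast
qed

text \<open>These are the atoms of the monoid. They turn out to be the unique minimal generating
  set, which evaluates the definite description in \<open>embedding_dim\<close>.\<close>

definition irreducibles :: "nat set \<Rightarrow> nat set" where
  "irreducibles S = {s \<in> S. s \<noteq> 0 \<and> (\<forall>x\<in>S. \<forall>y\<in>S. s = x + y \<longrightarrow> x = 0 \<or> y = 0)}"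

text \<open>The elements that are reducible or among the generators form a semigroup
  \<open>?T\<close>, since a sum of two nonzero elements is never irreducible. As \<open>?T\<close>
  contains every generator, it is everything.\<close>

lemma irreducibles_subset_generators:
  assumes "finite I"
  shows "irreducibles (generated I a) \<subseteq> a ` I"
proof -
  let ?S = "generated I a"
  let ?T = "{t \<in> ?S. t \<in> irreducibles ?S \<longrightarrow> t \<in> a ` I}"
  have "numerical_semigroup ?T"
    unfolding numerical_semigroup_def
  proof (intro conjI ballI)
    show "0 \<in> ?T"
      using numerical_semigroup_generated[of I a]
      by (auto simp: irreducibles_def numerical_semigroup_def)
    fix x y assume x: "x \<in> ?T" and y: "y \<in> ?T"
    then have "x + y \<in> ?S"
      using numerical_semigroup_generated[of I a] by (auto simp: numerical_semigroup_def)
    moreover have "x + y \<notin> irreducibles ?S" if "x \<noteq> 0" "y \<noteq> 0"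
      using that x y by (auto simp: irreducibles_def)
    ultimately show "x + y \<in> ?T"
      using x y by (cases "x = 0"; cases "y = 0") auto
  qed
  then have "?S \<subseteq> ?T"
    by (rule generated_subset) (use assms in \<open>auto intro: generated_mem\<close>)
  then show ?thesis
    by (auto simp: irreducibles_def)
qed

text \<open>Strong induction: a nonzero reducible element splits into two nonzero, hence strictly
  smaller, elements of \<open>S\<close>.\<close>

lemma generated_irreducibles:
  assumes S: "numerical_semigroup S" and fin: "finite (irreducibles S)"
  shows "generated (irreducibles S) id = S"
proof
  show "generated (irreducibles S) id \<subseteq> S"
    by (rule generated_subset[OF S]) (auto simp: irreducibles_def)
  define G where "G = generated (irreducibles S) id"
  have "s \<in> G" if "s \<in> S" for s
    using that
  proof (induction s rule: less_induct)
    case (less s)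
    have gen: "numerical_semigroup G"
      unfolding G_def by (rule numerical_semigroup_generated)
    consider "s = 0" | "s \<in> irreducibles S"
      | x y where "x \<in> S" "y \<in> S" "s = x + y" "x \<noteq> 0" "y \<noteq> 0"
      using less.prems by (auto simp: irreducibles_def)
    then show ?case
    proof cases
      case 1
      then show ?thesis using gen by (simp add: numerical_semigroup_def)
    next
      case 2
      then show ?thesis using generated_mem[OF fin 2, of id] by (simp add: G_def)
    next
      case 3
      then have "x \<in> G" "y \<in> G"
        using less.IH by auto
      then show ?thesis
        using gen 3 by (auto simp: numerical_semigroup_def)
    qed
  qed
  then show "S \<subseteq> generated (irreducibles S) id"
    by (auto simp: G_def)
qed

text \<open>Every finite generating set contains the irreducibles, and these already generate
  \<open>S\<close>; so no other set can be minimal.\<close>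

lemma minimal_generating_set_iff:
  assumes S: "numerical_semigroup S" and fin: "finite (irreducibles S)"
  shows "minimal_generating_set S A \<longleftrightarrow> A = irreducibles S"
proof -
  have sub: "irreducibles S \<subseteq> B" if "finite B" "generated B id = S" for B
    using irreducibles_subset_generators[OF that(1), of id] that(2) by simp
  have "minimal_generating_set S (irreducibles S)"
    unfolding minimal_generating_set_def
    using generated_irreducibles[OF assms] fin sub finite_subset
    by (metis psubsetE psubset_imp_subset)
  moreover have "A = irreducibles S" if "minimal_generating_set S A"
    using that sub[of A] generated_irreducibles[OF assms]
    unfolding minimal_generating_set_def by blast
  ultimately show ?thesis by blast
qed

lemma embedding_dim_eq:
  assumes "numerical_semigroup S" "finite (irreducibles S)"
  shows "embedding_dim S = card (irreducibles S)"
  by (simp add: embedding_dim_def minimal_generating_set_iff[OF assms])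

text \<open>Take denominator 1 and enumerate the irreducibles, which are positive. This shows that
  the \<open>LEAST\<close> in \<open>quotient_rank\<close> is attained and at most the embedding
  dimension.\<close>

lemma is_quotient_embedding_dim:
  assumes "numerical_semigroup S" "finite (irreducibles S)"
  shows "is_quotient (embedding_dim S) S"
proof -
  obtain f where f: "bij_betw f {..<embedding_dim S} (irreducibles S)"
    unfolding embedding_dim_eq[OF assms]
    using ex_bij_betw_nat_finite[OF assms(2)] by (metis atLeast0LessThan)
  have "S = semigroup_quotient (generated {..<embedding_dim S} f) 1"
    using generated_reindex[OF f, of id] generated_irreducibles[OF assms]
    by (simp add: semigroup_quotient_def)
  moreover have "\<forall>i<embedding_dim S. 0 < f i"
    using f by (force simp: bij_betw_def irreducibles_def)
  ultimately show ?thesis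
    unfolding is_quotient_def using assms(1) zero_less_one by blast
qed

text \<open>Always quotient rank \<le> embedding dimension \<le> \<open>n\<close>. The hypothesis
  makes the quotient rank at least \<open>n\<close>, so all three agree; possible repetitions among
  the \<open>a i\<close> need no separate treatment.\<close>

lemma full_quotient_rank_generated:
  assumes "\<And>k. k < n \<Longrightarrow> \<not> is_quotient k (generated {..<n} a)"
  shows "full_quotient_rank (generated {..<n} a)"
proof -
  let ?S = "generated {..<n} a"
  note sg = numerical_semigroup_generated[of "{..<n}" a]
  have sub: "irreducibles ?S \<subseteq> a ` {..<n}"
    by (rule irreducibles_subset_generators) simp
  then have fin: "finite (irreducibles ?S)"
    using finite_subset by blast
  have "embedding_dim ?S \<le> n"
    unfolding embedding_dim_eq[OF sg fin]
    using card_mono[OF _ sub] card_image_le[of "{..<n}" a] by simp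
  moreover note is_quotient_embedding_dim[OF sg fin]
  moreover from this have "is_quotient (quotient_rank ?S) ?S" "quotient_rank ?S \<le> embedding_dim ?S"
    unfolding quotient_rank_def by (auto intro: LeastI Least_le)
  ultimately show ?thesis
    unfolding full_quotient_rank_def using assms[of "quotient_rank ?S"] by linarith
qed

section \<open>Halving subset sums in a quotient\<close>

text \<open>There are \<open>2 ^ n\<close> index sets but only \<open>2 ^ k\<close> parity patterns,
  so two distinct sets share a pattern; their symmetric difference is the required set.\<close>

lemma even_subset_sums:
  fixes x :: "nat \<Rightarrow> nat \<Rightarrow> nat"
  assumes "k < n"
  obtains I where "I \<subseteq> {..<n}" "I \<noteq> {}" "\<forall>j<k. even (\<Sum>i\<in>I. x i j)"
proof -
  define odds where "odds I = {j. j < k \<and> odd (\<Sum>i\<in>I. x i j)}" for I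
  have "card (Pow {..<k}) < card (Pow {..<n})"
    using assms by (simp add: card_Pow)
  moreover have "odds ` Pow {..<n} \<subseteq> Pow {..<k}"
    by (auto simp: odds_def)
  ultimately have "\<not> inj_on odds (Pow {..<n})"
    using card_inj_on_le[of odds "Pow {..<n}" "Pow {..<k}"] by auto
  then obtain I J where IJ: "I \<subseteq> {..<n}" "J \<subseteq> {..<n}" "I \<noteq> J" "odds I = odds J"
    by (auto simp: inj_on_def)
  then have fin: "finite I" "finite J"
    using finite_subset by blast+
  \<comment> \<open>The intersection contributes equally to both sums, so modulo 2 the sum over the
    symmetric difference is the sum of the two.\<close>
  have "even (\<Sum>i\<in>(I - J) \<union> (J - I). x i j)" if "j < k" for j
  proof -
    have "even (\<Sum>i\<in>I. x i j) = even (\<Sum>i\<in>J. x i j)"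
      using IJ(4) that by (auto simp: odds_def)
    moreover have "(\<Sum>i\<in>I. x i j) = (\<Sum>i\<in>I - J. x i j) + (\<Sum>i\<in>I \<inter> J. x i j)"
      using sum.Int_Diff[OF fin(1), of _ J] by (simp add: add.commute)
    moreover have "(\<Sum>i\<in>J. x i j) = (\<Sum>i\<in>J - I. x i j) + (\<Sum>i\<in>I \<inter> J. x i j)"
      using sum.Int_Diff[OF fin(2), of _ I] by (simp add: add.commute Int_commute)
    moreover have "(\<Sum>i\<in>(I - J) \<union> (J - I). x i j) = (\<Sum>i\<in>I - J. x i j) + (\<Sum>i\<in>J - I. x i j)"
      using fin by (intro sum.union_disjoint) auto
    ultimately show ?thesis by auto
  qed
  moreover have "(I - J) \<union> (J - I) \<subseteq> {..<n}" "(I - J) \<union> (J - I) \<noteq> {}"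
    using IJ by auto
  ultimately show ?thesis using that by blast
qed

text \<open>Halving \<open>d\<close> and all \<open>c j\<close> together does not change the
  quotient, and the descent stops because \<open>d\<close> decreases.\<close>

lemma semigroup_quotient_not_all_even:
  assumes "d > 0"
  shows "\<exists>d'>0. \<exists>c'. semigroup_quotient (generated {..<k} c) d = semigroup_quotient (generated {..<k} c') d'
    \<and> (odd d' \<or> (\<exists>j<k. odd (c' j)))"
  using assms
proof (induction d arbitrary: c rule: less_induct)
  case (less d)
  show ?case
  proof (cases "odd d \<or> (\<exists>j<k. odd (c j))")
    case True
    then show ?thesis using less.prems by blast
  next
    case False
    then have d: "d = 2 * (d div 2)" and c: "\<And>j. j < k \<Longrightarrow> c j = 2 * (c j div 2)"
      by auto
    have sum: "(\<Sum>j<k. c j * x j) = 2 * (\<Sum>j<k. c j div 2 * x j)" for x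
      unfolding sum_distrib_left by (intro sum.cong) (use c in \<open>auto simp flip: mult.assoc\<close>)
    have "d * t = 2 * s \<longleftrightarrow> d div 2 * t = s" for t s
      by (subst d) simp
    then have "semigroup_quotient (generated {..<k} c) d
        = semigroup_quotient (generated {..<k} (\<lambda>j. c j div 2)) (d div 2)"
      by (auto simp: semigroup_quotient_def generated_def sum)
    moreover have "d div 2 < d" "d div 2 > 0"
      using less.prems d by linarith+
    ultimately show ?thesis
      using less.IH by metis
  qed
qed

text \<open>It suffices that the subset sum of the \<open>a i\<close> and the \<open>k\<close>
  coefficient sums of its multiple by \<open>d\<close> are all even. These are \<open>k + 1\<close>
  parity conditions, one more than the pigeonhole argument allows; the normalisation of
  \<open>d\<close> and \<open>c\<close> makes one of them follow from the others.\<close>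

lemma quotient_half_subset_sum:
  assumes S: "is_quotient k S" and "k < n" and a: "\<And>i. i < n \<Longrightarrow> a i \<in> S"
  shows "\<exists>I\<subseteq>{..<n}. I \<noteq> {} \<and> (\<exists>t\<in>S. (\<Sum>i\<in>I. a i) = 2 * t)"
proof -
  obtain d c where d: "d > 0" and S_eq: "S = semigroup_quotient (generated {..<k} c) d"
    and odd: "odd d \<or> (\<exists>j<k. odd (c j))"
    using S semigroup_quotient_not_all_even unfolding is_quotient_def by metis
  have "\<forall>i. \<exists>y. i < n \<longrightarrow> d * a i = (\<Sum>j<k. c j * y j)"
    using a by (auto simp: S_eq semigroup_quotient_def generated_def)
  then obtain x where x: "\<And>i. i < n \<Longrightarrow> d * a i = (\<Sum>j<k. c j * x i j)"
    by metis
  have sums: "d * (\<Sum>i\<in>I. a i) = (\<Sum>j<k. c j * (\<Sum>i\<in>I. x i j))" if "I \<subseteq> {..<n}" for I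
  proof -
    have "d * (\<Sum>i\<in>I. a i) = (\<Sum>i\<in>I. \<Sum>j<k. c j * x i j)"
      unfolding sum_distrib_left by (intro sum.cong refl x) (use that in auto)
    then show ?thesis
      by (subst (asm) sum.swap) (simp add: sum_distrib_left)
  qed
  obtain I where I: "I \<subseteq> {..<n}" "I \<noteq> {}" "even (\<Sum>i\<in>I. a i)" "\<forall>j<k. even (\<Sum>i\<in>I. x i j)"
  proof (cases "odd d")
    \<comment> \<open>For odd \<open>d\<close> the condition on the \<open>a i\<close> is the one
      that follows: even coefficient sums make \<open>d\<close> times the subset sum even.\<close>
    case True
    obtain I where I: "I \<subseteq> {..<n}" "I \<noteq> {}" "\<forall>j<k. even (\<Sum>i\<in>I. x i j)"
      by (rule even_subset_sums[OF \<open>k < n\<close>, of x])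
    then have "even (d * (\<Sum>i\<in>I. a i))"
      unfolding sums[OF I(1)] by (intro dvd_sum) auto
    then show ?thesis
      using True I that by auto
  next
    case False
    then obtain j0 where j0: "j0 < k" "odd (c j0)"
      using odd by blast
    \<comment> \<open>Evenness of the \<open>j0\<close>-th coordinate comes for free, as \<open>d\<close> is even and \<open>c j0\<close> is odd; this
      leaves room for the condition on the \<open>a i\<close>.\<close>
    obtain I where I: "I \<subseteq> {..<n}" "I \<noteq> {}"
      and ev: "\<forall>j<k. even (\<Sum>i\<in>I. if j = j0 then a i else x i j)"
      by (rule even_subset_sums[OF \<open>k < n\<close>, of "\<lambda>i j. if j = j0 then a i else x i j"])
    have ev': "even (\<Sum>i\<in>I. x i j)" if "j < k" "j \<noteq> j0" for j
      using ev[rule_format, OF that(1)] that(2) by simp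
    have "d * (\<Sum>i\<in>I. a i)
        = c j0 * (\<Sum>i\<in>I. x i j0) + (\<Sum>j\<in>{..<k} - {j0}. c j * (\<Sum>i\<in>I. x i j))"
      unfolding sums[OF I(1)] using j0 by (intro sum.remove) auto
    then have "even (c j0 * (\<Sum>i\<in>I. x i j0) + (\<Sum>j\<in>{..<k} - {j0}. c j * (\<Sum>i\<in>I. x i j)))"
      using False by (metis dvd_mult2)
    moreover have "even (\<Sum>j\<in>{..<k} - {j0}. c j * (\<Sum>i\<in>I. x i j))"
      by (intro dvd_sum) (use ev' in auto)
    ultimately have "even (\<Sum>i\<in>I. x i j0)"
      using j0(2) by simp
    then have "\<forall>j<k. even (\<Sum>i\<in>I. x i j)"
      using ev' by blast
    moreover have "even (\<Sum>i\<in>I. a i)"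
      using ev[rule_format, OF j0(1)] by simp
    ultimately show ?thesis
      using that[of I] I by blast
  qed
  define t where "t = (\<Sum>i\<in>I. a i) div 2"
  have t: "(\<Sum>i\<in>I. a i) = 2 * t"
    using I(3) by (simp add: t_def)
  \<comment> \<open>Halving the even coefficient sums represents \<open>d * t\<close> by the
    \<open>c j\<close>.\<close>
  have "2 * (d * t) = (\<Sum>j<k. c j * (\<Sum>i\<in>I. x i j))"
    using sums[OF I(1)] t by (simp add: algebra_simps)
  also have "\<dots> = 2 * (\<Sum>j<k. c j * ((\<Sum>i\<in>I. x i j) div 2))"
    unfolding sum_distrib_left[of 2]
  proof (intro sum.cong refl)
    fix j assume "j \<in> {..<k}"
    then obtain m where "(\<Sum>i\<in>I. x i j) = 2 * m"
      using I(4) by (auto elim: evenE)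
    then show "c j * (\<Sum>i\<in>I. x i j) = 2 * (c j * ((\<Sum>i\<in>I. x i j) div 2))"
      by simp
  qed
  finally have "t \<in> S"
    by (auto simp: S_eq semigroup_quotient_def generated_def)
  then show ?thesis
    using I t by blast
qed

section \<open>Counting\<close>

text \<open>As \<open>e i\<close> is nonzero, the other coordinates determine \<open>a i\<close>.
  Overwriting it with the default 0 is therefore injective on the solutions and lands in a product
  with one factor fewer.\<close>

lemma card_PiE_dflt_linear_equation:
  fixes e :: "'i \<Rightarrow> int" and A :: "'i set"
  assumes "finite A" "i \<in> A" "e i \<noteq> 0"
  shows "card {a \<in> PiE_dflt A 0 (\<lambda>_. {1..M}). (\<Sum>j\<in>A. e j * int (a j)) = 0} \<le> M ^ (card A - 1)"
proof -
  let ?X = "{a \<in> PiE_dflt A 0 (\<lambda>_. {1..M}). (\<Sum>j\<in>A. e j * int (a j)) = 0}"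
  let ?Y = "PiE_dflt (A - {i}) 0 (\<lambda>_. {1..M})"
  have "inj_on (\<lambda>a. a(i := 0)) ?X"
  proof (rule inj_onI)
    fix a b assume a: "a \<in> ?X" and b: "b \<in> ?X" and eq: "a(i := 0) = b(i := 0)"
    then have same: "a j = b j" if "j \<noteq> i" for j
      using that by (metis fun_upd_other)
    then have "(\<Sum>j\<in>A - {i}. e j * int (a j)) = (\<Sum>j\<in>A - {i}. e j * int (b j))"
      by (intro sum.cong) auto
    moreover have "e i * int (a i) + (\<Sum>j\<in>A - {i}. e j * int (a j)) = 0"
      "e i * int (b i) + (\<Sum>j\<in>A - {i}. e j * int (b j)) = 0"
      using a b assms(1,2) by (auto simp: sum.remove)
    ultimately have "e i * int (a i) = e i * int (b i)"
      by linarith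
    then have "a i = b i"
      using assms(3) by simp
    then show "a = b"
      using same by (metis ext)
  qed
  moreover have "(\<lambda>a. a(i := 0)) ` ?X \<subseteq> ?Y"
    by (auto simp: PiE_dflt_def)
  moreover have "finite ?Y"
    using assms(1) by (intro finite_PiE_dflt) auto
  ultimately have "card ?X \<le> card ?Y"
    by (rule card_inj_on_le)
  also have "\<dots> = M ^ (card A - 1)"
    using assms by (subst card_PiE_dflt) auto
  finally show ?thesis .
qed

text \<open>The constrained set is again a product, with the factor at \<open>i\<close> shrunk to
  \<open>B\<close>. It serves to count tuples with a small entry.\<close>

lemma card_PiE_dflt_component:
  assumes "finite A" "i \<in> A" "finite B" "B \<subseteq> {1..M}"
  shows "card {a \<in> PiE_dflt A 0 (\<lambda>_. {1..M}). a i \<in> B} = card B * M ^ (card A - 1)"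
proof -
  have "{a \<in> PiE_dflt A 0 (\<lambda>_. {1..M}). a i \<in> B} = PiE_dflt A 0 (\<lambda>j. if j = i then B else {1..M})"
  proof (intro set_eqI iffI)
    fix a assume "a \<in> PiE_dflt A 0 (\<lambda>j. if j = i then B else {1..M})"
    then have "\<And>j. j \<in> A \<Longrightarrow> a j \<in> (if j = i then B else {1..M})" "\<And>j. j \<notin> A \<Longrightarrow> a j = 0"
      by (auto simp: PiE_dflt_def)
    then show "a \<in> {a \<in> PiE_dflt A 0 (\<lambda>_. {1..M}). a i \<in> B}"
      using assms(2,4) unfolding PiE_dflt_def mem_Collect_eq by (metis subsetD)
  qed (auto simp: PiE_dflt_def)
  also have "card \<dots> = (\<Prod>j\<in>A. card (if j = i then B else {1..M}))"
    using assms by (subst card_PiE_dflt) auto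
  also have "\<dots> = card B * M ^ (card A - 1)"
    using assms by (subst prod.remove[of _ i]) auto
  finally show ?thesis .
qed

text \<open>The subset sum is at most \<open>n * a j\<close>, hence so is each
  \<open>a i * y i\<close>. Cancelling \<open>a j\<close> bounds \<open>y j\<close> independently of
  \<open>K\<close>; for the other indices, \<open>a j \<le> M < a i * K\<close> costs a factor
  \<open>K\<close>. The better bound at \<open>j\<close> is what keeps the number of coefficient
  vectors of order \<open>K ^ (n - 1)\<close>.\<close>

lemma half_subset_sum_coefficients:
  fixes a y :: "nat \<Rightarrow> nat"
  assumes I: "I \<subseteq> {..<n}" and j: "j < n" "\<And>i. i < n \<Longrightarrow> a i \<le> a j"
    and pos: "\<And>i. i < n \<Longrightarrow> a i > 0"
    and large: "\<And>i. i < n \<Longrightarrow> M < a i * K" and "a j \<le> M"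
    and eq: "(\<Sum>i\<in>I. a i) = 2 * (\<Sum>i<n. a i * y i)"
  shows "y j \<le> n" "\<And>i. i < n \<Longrightarrow> y i \<le> n * K"
proof -
  have "(\<Sum>i\<in>I. a i) \<le> (\<Sum>i<n. a i)"
    using I by (intro sum_mono2) auto
  also have "\<dots> \<le> n * a j"
    using sum_bounded_above[of "{..<n}" a "a j"] j by simp
  finally have "(\<Sum>i<n. a i * y i) \<le> n * a j"
    using eq by simp
  then have le: "a i * y i \<le> n * a j" if "i < n" for i
    using that member_le_sum[of i "{..<n}" "\<lambda>i. a i * y i"] by fastforce
  show "y j \<le> n"
    using le[OF j(1)] pos[OF j(1)] by (simp add: mult.commute)
  show "y i \<le> n * K" if "i < n" for i
  proof -
    have "a i * y i \<le> n * M"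
      using le[OF that] \<open>a j \<le> M\<close> by (meson le_trans mult_le_mono2)
    also have "\<dots> \<le> n * (a i * K)"
      using large[OF that] by (intro mult_le_mono2) simp
    finally have "a i * y i \<le> a i * (n * K)"
      by (simp add: algebra_simps)
    then show ?thesis
      using pos[OF that] by simp
  qed
qed

text \<open>The semigroup is a \<open>k\<close>-quotient with \<open>k < n\<close> containing all
  \<open>a i\<close>, so half of some subset sum lies in it and expands in the generators.\<close>

lemma not_full_quotient_rank_relation:
  fixes a :: "nat \<Rightarrow> nat"
  assumes "\<not> full_quotient_rank (generated {..<n} a)"
  shows "\<exists>I\<subseteq>{..<n}. I \<noteq> {} \<and> (\<exists>y. (\<Sum>i\<in>I. a i) = 2 * (\<Sum>i<n. a i * y i))"
proof -
  obtain k where k: "k < n" "is_quotient k (generated {..<n} a)"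
    using full_quotient_rank_generated assms by blast
  have "\<exists>I\<subseteq>{..<n}. I \<noteq> {} \<and> (\<exists>t\<in>generated {..<n} a. (\<Sum>i\<in>I. a i) = 2 * t)"
    by (rule quotient_half_subset_sum[OF k(2,1)]) (auto intro: generated_mem)
  then show ?thesis
    by (auto simp: generated_def)
qed

text \<open>Union bound. The first term counts tuples with an entry at most \<open>M div K\<close>.
  The second multiplies the choices of the index \<open>j\<close> of a maximal entry, of
  \<open>I\<close>, and of \<open>y\<close> by the number of solutions of one equation.\<close>

lemma card_not_full_quotient_rank_le:
  assumes "n > 0" "K > 0"
  shows "card {a \<in> PiE_dflt {..<n} 0 (\<lambda>_. {1..M}). \<not> full_quotient_rank (generated {..<n} a)}
    \<le> n * (M div K) * M ^ (n - 1) + n * 2 ^ n * (n + 1) * ((n + 1) * K) ^ (n - 1) * M ^ (n - 1)"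
    (is "card ?bad \<le> _")
proof -
  define D where "D = PiE_dflt {..<n} (0::nat) (\<lambda>_. {1..M})"
  define small where "small i = {a \<in> D. a i \<in> {1..M div K}}" for i
  \<comment> \<open>The box of coefficient vectors that can occur when \<open>a j\<close> is maximal
    and no entry is small; the default 0 outside \<open>{..<n}\<close> keeps it finite.\<close>
  define Y where "Y j = PiE_dflt {..<n} (0::nat) (\<lambda>i. if i = j then {..n} else {..n * K})" for j
  define sol where "sol I y = {a \<in> D. (\<Sum>i\<in>I. a i) = 2 * (\<Sum>i<n. a i * y i)}" for I and y :: "nat \<Rightarrow> nat"
  define P where "P = Pow {..<n} - {{}}"
  have finY: "finite (Y j)" for j
    unfolding Y_def by (intro finite_PiE_dflt) auto
  have finP: "finite P" and cardP: "card P \<le> 2 ^ n"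
    unfolding P_def by (auto simp: card_Pow intro: order.trans[OF card_Diff1_le])
  have finD: "finite D"
    unfolding D_def by (intro finite_PiE_dflt) auto
  have card_small: "card (small i) \<le> M div K * M ^ (n - 1)" if "i < n" for i
  proof -
    have "{1..M div K} \<subseteq> {1..M}"
      using div_le_dividend[of M K] by auto
    then show ?thesis
      using card_PiE_dflt_component[of "{..<n}" i "{1..M div K}" M] that
      by (simp add: small_def D_def)
  qed
  have card_Y: "card (Y j) \<le> (n + 1) * ((n + 1) * K) ^ (n - 1)" if "j < n" for j
  proof -
    have "card (Y j) = (\<Prod>i<n. card (if i = j then {..n} else {..n * K}))"
      unfolding Y_def by (subst card_PiE_dflt) auto
    also have "\<dots> = (n + 1) * (n * K + 1) ^ (n - 1)"
      using that by (subst prod.remove[of _ j]) auto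
    also have "\<dots> \<le> (n + 1) * ((n + 1) * K) ^ (n - 1)"
      using assms(2) by (intro mult_le_mono2 power_mono) auto
    finally show ?thesis .
  qed
  have card_sol: "card (sol I y) \<le> M ^ (n - 1)" if I: "I \<in> P" for I y
  proof -
    obtain i where i: "i \<in> I" "i < n" and In: "I \<subseteq> {..<n}"
      using I by (auto simp: P_def)
    \<comment> \<open>The relation with all terms on one side; \<open>e i\<close> is odd, hence
      nonzero, for \<open>i\<close> in \<open>I\<close>.\<close>
    define e where "e i = of_bool (i \<in> I) - 2 * int (y i)" for i
    have "(\<Sum>i<n. e i * int (a i)) = 0"
      if "(\<Sum>i\<in>I. a i) = 2 * (\<Sum>i<n. a i * y i)" for a
    proof -
      have "(\<Sum>i<n. e i * int (a i))
          = (\<Sum>i<n. if i \<in> I then int (a i) else 0) - 2 * (\<Sum>i<n. int (a i * y i))"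
        unfolding sum_distrib_left sum_subtractf[symmetric]
        by (intro sum.cong) (auto simp: e_def algebra_simps)
      also have "(\<Sum>i<n. if i \<in> I then int (a i) else 0) = int (\<Sum>i\<in>I. a i)"
        using In by (simp add: sum.If_cases Int_absorb1)
      finally show ?thesis using that by simp
    qed
    then have "sol I y \<subseteq> {a \<in> D. (\<Sum>i<n. e i * int (a i)) = 0}"
      by (auto simp: sol_def)
    then have "card (sol I y) \<le> card {a \<in> D. (\<Sum>i<n. e i * int (a i)) = 0}"
      using finD by (intro card_mono) auto
    moreover have "e i \<noteq> 0"
      using i by (simp add: e_def) presburger
    ultimately show ?thesis
      using card_PiE_dflt_linear_equation[of "{..<n}" i e M] i(2) by (simp add: D_def)
  qed
  have cover: "?bad \<subseteq> (\<Union>i<n. small i) \<union> (\<Union>j<n. \<Union>I\<in>P. \<Union>y\<in>Y j. sol I y)"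
  proof
    fix a assume a: "a \<in> ?bad"
    then have aD: "a \<in> D"
      by (simp add: D_def)
    then have range: "0 < a i" "a i \<le> M" if "i < n" for i
      using that by (fastforce simp: D_def PiE_dflt_def)+
    show "a \<in> (\<Union>i<n. small i) \<union> (\<Union>j<n. \<Union>I\<in>P. \<Union>y\<in>Y j. sol I y)"
    proof (cases "\<exists>i<n. a i * K \<le> M")
      case True
      then obtain i where i: "i < n" "a i \<le> M div K"
        using assms(2) by (auto simp: less_eq_div_iff_mult_less_eq)
      then show ?thesis
        using aD range(1)[OF i(1)] by (auto simp: small_def Suc_le_eq)
    next
      case False
      obtain I y where I: "I \<subseteq> {..<n}" "I \<noteq> {}" and eq: "(\<Sum>i\<in>I. a i) = 2 * (\<Sum>i<n. a i * y i)"
        using not_full_quotient_rank_relation[of n a] a by auto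
      obtain j where j: "j < n" "\<And>i. i < n \<Longrightarrow> a i \<le> a j"
      proof -
        have "Max (a ` {..<n}) \<in> a ` {..<n}"
          using assms(1) by (intro Max_in) auto
        then obtain j where "j < n" "a j = Max (a ` {..<n})" by auto
        then show ?thesis using that by simp
      qed
      \<comment> \<open>The values of \<open>y\<close> outside \<open>{..<n}\<close> are arbitrary;
        resetting them to the default is needed for membership in \<open>Y j\<close> and leaves the
        relation unchanged.\<close>
      define z where "z i = (if i < n then y i else 0)" for i
      have eqz: "(\<Sum>i\<in>I. a i) = 2 * (\<Sum>i<n. a i * z i)"
        using eq by (simp add: z_def)
      have "z j \<le> n" "\<And>i. i < n \<Longrightarrow> z i \<le> n * K"
        using half_subset_sum_coefficients[OF I(1) j range(1) _ range(2)[OF j(1)] eqz, of K] False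
        by (auto simp: not_le)
      then have "z \<in> Y j"
        by (auto simp: Y_def PiE_dflt_def z_def)
      moreover have "a \<in> sol I z"
        using aD eqz by (simp add: sol_def)
      moreover have "I \<in> P"
        using I by (auto simp: P_def)
      ultimately show ?thesis
        using j(1) by blast
    qed
  qed
  have "card (\<Union>i<n. small i) \<le> (\<Sum>i<n. card (small i))"
    by (rule card_UN_le) simp
  also have "\<dots> \<le> n * (M div K * M ^ (n - 1))"
    using sum_bounded_above[of "{..<n}" "\<lambda>i. card (small i)"] card_small by fastforce
  finally have small: "card (\<Union>i<n. small i) \<le> n * (M div K) * M ^ (n - 1)"
    by (simp add: mult.assoc)
  let ?c = "(n + 1) * ((n + 1) * K) ^ (n - 1)"
  have "card (\<Union>y\<in>Y j. sol I y) \<le> ?c * M ^ (n - 1)" if "j < n" "I \<in> P" for j I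
  proof -
    have "card (\<Union>y\<in>Y j. sol I y) \<le> (\<Sum>y\<in>Y j. card (sol I y))"
      by (rule card_UN_le[OF finY])
    also have "\<dots> \<le> card (Y j) * M ^ (n - 1)"
      using sum_bounded_above[of "Y j" "\<lambda>y. card (sol I y)"] card_sol[OF that(2)] by fastforce
    also have "\<dots> \<le> ?c * M ^ (n - 1)"
      using card_Y[OF that(1)] by (rule mult_le_mono1)
    finally show ?thesis .
  qed
  note 1 = this
  have 2: "card (\<Union>I\<in>P. \<Union>y\<in>Y j. sol I y) \<le> 2 ^ n * (?c * M ^ (n - 1))" if "j < n" for j
  proof -
    have "card (\<Union>I\<in>P. \<Union>y\<in>Y j. sol I y) \<le> (\<Sum>I\<in>P. card (\<Union>y\<in>Y j. sol I y))"
      by (rule card_UN_le[OF finP])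
    also have "\<dots> \<le> card P * (?c * M ^ (n - 1))"
      using sum_bounded_above[of P "\<lambda>I. card (\<Union>y\<in>Y j. sol I y)"] 1[OF that] by fastforce
    also have "\<dots> \<le> 2 ^ n * (?c * M ^ (n - 1))"
      using cardP by (rule mult_le_mono1)
    finally show ?thesis .
  qed
  have "card (\<Union>j<n. \<Union>I\<in>P. \<Union>y\<in>Y j. sol I y) \<le> (\<Sum>j<n. card (\<Union>I\<in>P. \<Union>y\<in>Y j. sol I y))"
    by (rule card_UN_le) simp
  also have "\<dots> \<le> n * (2 ^ n * (?c * M ^ (n - 1)))"
    using sum_bounded_above[of "{..<n}" "\<lambda>j. card (\<Union>I\<in>P. \<Union>y\<in>Y j. sol I y)"] 2 by fastforce
  finally have sols: "card (\<Union>j<n. \<Union>I\<in>P. \<Union>y\<in>Y j. sol I y) 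
      \<le> n * 2 ^ n * (n + 1) * ((n + 1) * K) ^ (n - 1) * M ^ (n - 1)"
    by (simp only: mult.assoc)
  have "finite ((\<Union>i<n. small i) \<union> (\<Union>j<n. \<Union>I\<in>P. \<Union>y\<in>Y j. sol I y))"
    by (rule finite_subset[OF _ finD]) (auto simp: small_def sol_def)
  then have "card ?bad \<le> card ((\<Union>i<n. small i) \<union> (\<Union>j<n. \<Union>I\<in>P. \<Union>y\<in>Y j. sol I y))"
    using cover by (rule card_mono)
  also have "\<dots> \<le> card (\<Union>i<n. small i) + card (\<Union>j<n. \<Union>I\<in>P. \<Union>y\<in>Y j. sol I y)"
    by (rule card_Un_le)
  also note add_mono[OF small sols]
  finally show ?thesis .
qed

section \<open>The probability bound\<close>

text \<open>Independent uniform coordinates give the uniform law on the product, which has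
  \<open>M ^ n\<close> points.\<close>

lemma one_minus_prob_full_quotient_rank:
  assumes "M > 0"
  shows "1 - prob_full_quotient_rank n M =
    card {a \<in> PiE_dflt {..<n} 0 (\<lambda>_. {1..M}). \<not> full_quotient_rank (generated {..<n} a)} / real M ^ n"
proof -
  let ?D = "PiE_dflt {..<n} (0::nat) (\<lambda>_. {1..M})"
  let ?full = "{a. full_quotient_rank (generated {..<n} a)}"
  have rg: "random_generators n M = pmf_of_set ?D"
    unfolding random_generators_def using assms by (subst Pi_pmf_of_set) auto
  have fin: "finite ?D"
    by (intro finite_PiE_dflt) auto
  have card: "card ?D = M ^ n"
    by (subst card_PiE_dflt) auto
  have ne: "?D \<noteq> {}"
    using card assms by auto
  have "1 - prob_full_quotient_rank n M = measure_pmf.prob (pmf_of_set ?D) (- ?full)"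
    unfolding prob_full_quotient_rank_def rg
    by (subst measure_pmf.prob_compl[symmetric]) (auto simp: Compl_eq_Diff_UNIV)
  also have "\<dots> = card (?D \<inter> - ?full) / card ?D"
    by (rule measure_pmf_of_set[OF ne fin])
  also have "?D \<inter> - ?full = {a \<in> ?D. \<not> full_quotient_rank (generated {..<n} a)}"
    by auto
  finally show ?thesis
    by (simp only: card of_nat_power)
qed

text \<open>Choose \<open>K\<close> as the ceiling of \<open>r = M powr (1 / n)\<close>. Then
  \<open>M div K\<close> is at most \<open>M / r\<close>, and \<open>K ^ (n - 1)\<close> is at most
  a constant times \<open>r ^ (n - 1) = M / r\<close>. Both terms of the count are thus of order
  \<open>M ^ n / r\<close>.\<close>

lemma one_minus_prob_full_quotient_rank_le:
  assumes "n > 0" "M > 0"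
  shows "1 - prob_full_quotient_rank n M
    \<le> (n + n * 2 ^ n * (n + 1) * (2 * (real n + 1)) ^ (n - 1)) * real M powr (- 1 / n)"
proof -
  define r where "r = real M powr (1 / n)"
  define K where "K = nat \<lceil>r\<rceil>"
  have r: "r \<ge> 1"
    using assms by (simp add: r_def ge_one_powr_ge_zero)
  \<comment> \<open>The ceiling is at most \<open>r + 1\<close>, and \<open>r \<ge> 1\<close>; this
    is the source of the factor 2 in the constant.\<close>
  have Kr: "r \<le> K" "real K \<le> 2 * r"
    using r by (auto simp: K_def) linarith+
  then have K: "K > 0"
    using r by (cases K) auto
  have rn: "r ^ n = M"
    using assms by (simp add: r_def powr_powr flip: powr_realpow)
  then have Mr: "real M = r * r ^ (n - 1)"
    using assms by (metis power_eq_if neq0_conv)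
  have Mn: "real M ^ n = M * real M ^ (n - 1)"
    using assms by (metis power_eq_if neq0_conv)
  have inv: "real M powr (- 1 / n) = 1 / r"
    by (simp add: r_def powr_minus_divide flip: minus_divide_left)
  let ?c = "real n * 2 ^ n * (real n + 1)"
  let ?B = "{a \<in> PiE_dflt {..<n} 0 (\<lambda>_. {1..M}). \<not> full_quotient_rank (generated {..<n} a)}"
  have "real (card ?B) \<le> real (n * (M div K) * M ^ (n - 1)
      + n * 2 ^ n * (n + 1) * ((n + 1) * K) ^ (n - 1) * M ^ (n - 1))"
    using card_not_full_quotient_rank_le[OF assms(1) K, of M] by (simp only: of_nat_le_iff)
  also have "\<dots> = (n * real (M div K) + ?c * ((n + 1) * K) ^ (n - 1)) * real M ^ (n - 1)"
    by (simp add: algebra_simps)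
  also have "\<dots> \<le> (n * (M / r) + ?c * ((n + 1) * (2 * r)) ^ (n - 1)) * real M ^ (n - 1)"
  proof -
    have "real (M div K) \<le> M / K"
      by (rule of_nat_div_le_of_nat)
    also have "\<dots> \<le> M / r"
      using Kr r by (intro divide_left_mono) auto
    finally have "real (M div K) \<le> M / r" .
    moreover have "real ((n + 1) * K) ^ (n - 1) \<le> ((n + 1) * (2 * r)) ^ (n - 1)"
      unfolding of_nat_mult by (intro power_mono mult_left_mono Kr) auto
    ultimately show ?thesis
      by (intro mult_right_mono add_mono mult_left_mono) auto
  qed
  also have "((n + 1) * (2 * r)) ^ (n - 1) = (2 * (real n + 1)) ^ (n - 1) * (M / r)"
    using r Mr by (simp add: power_mult_distrib[symmetric] algebra_simps)
  \<comment> \<open>Pulls out the common \<open>1 / r\<close> and collects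
    \<open>M * M ^ (n - 1)\<close>, which then cancels against the number of all tuples.\<close>
  also have "(x * (m / r) + c * (q * (m / r))) * p = (x + c * q) * (1 / r) * (m * p)"
    for x m c q p :: real
    by (simp add: algebra_simps add_divide_distrib)
  finally have "real (card ?B)
      \<le> (n + ?c * (2 * (real n + 1)) ^ (n - 1)) * (1 / r) * (M * real M ^ (n - 1))" .
  then have "card ?B / real M ^ n \<le> (n + ?c * (2 * (real n + 1)) ^ (n - 1)) * (1 / r)"
    using assms by (subst divide_le_eq) (simp add: Mn)
  then show ?thesis
    unfolding one_minus_prob_full_quotient_rank[OF assms(2)] inv .
qed

theorem theorem4p1:
  fixes n :: nat
  assumes "n > 0"
  shows "(\<lambda>M. prob_full_quotient_rank n M) \<longlonglongrightarrow> 1 \<and>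
         (\<lambda>M. 1 - prob_full_quotient_rank n M) \<in> O(\<lambda>M. real M powr (- 1 / real n))"
proof -
  let ?f = "\<lambda>M. 1 - prob_full_quotient_rank n M"
  let ?C = "real n + real n * 2 ^ n * (real n + 1) * (2 * (real n + 1)) ^ (n - 1)"
  have nonneg: "?f M \<ge> 0" for M
    by (simp add: prob_full_quotient_rank_def)
  have le: "norm (?f M) \<le> ?C * norm (real M powr (- 1 / real n))" if "M > 0" for M
    using one_minus_prob_full_quotient_rank_le[OF assms that]
    by (simp only: real_norm_def abs_of_nonneg[OF nonneg] abs_of_nonneg[OF powr_ge_zero])
  then have O: "?f \<in> O(\<lambda>M. real M powr (- 1 / real n))"
    by (intro bigoI[of _ ?C] eventually_mono[OF eventually_gt_at_top[of 0]])
  \<comment> \<open>The limit follows from the rate by comparison, since the exponent is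
    negative.\<close>
  have "(\<lambda>M. real M powr (- 1 / real n)) \<longlonglongrightarrow> 0"
    using assms by (intro tendsto_neg_powr filterlim_real_sequentially) auto
  then have "(\<lambda>M. ?C * norm (real M powr (- 1 / real n))) \<longlonglongrightarrow> 0"
    by (intro tendsto_mult_right_zero tendsto_norm_zero)
  then have "?f \<longlonglongrightarrow> 0"
    by (rule Lim_null_comparison[rotated]) (use le in \<open>auto intro!: eventually_sequentiallyI[of 1]\<close>)
  then have "(\<lambda>M. 1 - ?f M) \<longlonglongrightarrow> 1 - 0"
    by (intro tendsto_diff tendsto_const)
  then show ?thesis
    using O by simp
qed

end
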